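(* Let $F$, $\alpha$ and $K\ge2$ be positive integers with $\alpha\in\{1,\dots,F-1\}$. Let $P_\alpha$ be the $\binom F\alpha\times F$ array with rows indexed by the $\alpha$-subsets $T$ of $[F]$, columns indexed by $d\in[F]$, and entries $$p_{T,d}=\begin{cases} * & \text{if } d\in T,\\ y_{\alpha+1}(T\cup\{d\}) & \text{if } d\notin T,\end{cases}$$ where $y_{\alpha+1}(Y)$ denotes the position of the $(\alpha+1)$-subset $Y$ in the lexicographic ordering of all $(\alpha+1)$-subsets of $[F]$. Let $\mathbf P^{(1)}_\alpha$ be the transpose of $P_\alpha$, and let $\mathbf P$ be the $K\times K$ block array whose diagonal blocks are all equal to $\mathbf P^{(1)}_\alpha$ and whose off-diagonal blocks are all equal to the $F\times\binom F\alpha$ array with every entry $*$. Then: 1. $P_\alpha$ is an $(\alpha+1)$-$\left(F,\binom F\alpha,\binom{F-1}{\alpha-1},\binom F{\alpha+1}\right)$ PDA; 2. $\mathbf P^{(1)}_\alpha$ is an $(\alpha+1)$-$\left(\binom F\alpha,F,\alpha,\binom F{\alpha+1}\right)$ PDA; 3. $\mathbf P$ is a $\left(K\binom F\alpha,\;KF,\;(K-1)F+\alpha,\;\binom F{\alpha+1}\right)$ PDA.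
   Context: Notation: $[n]=\{1,\dots,n\}$. **Placement delivery array (PDA).** For positive integers $K,F,Z,S$, an $F\times K$ array $P=[p_{f,k}]$, $f\in[F]$, $k\in[K]$, whose entries are either the special symbol $*$ or integers in $[S]$, is a $(K,F,Z,S)$ PDA if: - (A1) the symbol $*$ appears exactly $Z$ times in each column; - (A2) each integer in $[S]$ occurs at least once in the array; - (A3) for any two distinct entries with $p_{f_1,k_1}=p_{f_2,k_2}=s$ an integer, one has $f_1\neq f_2$, $k_1\neq k_2$, and $p_{f_1,k_2}=p_{f_2,k_1}=*$. Note that the first parameter is the number of columns and the second is the number of rows. A $g$-$(K,F,Z,S)$ PDA ($g$-regular PDA) is such an array satisfying A1, A3 and (A2') each integer in $[S]$ appears exactly $g$ times. *)

theory Defs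
  imports Main "HOL-Library.Ramsey"
begin

datatype entry = Star | Num nat

text \<open>
  An array is a function of a row label and a column label, together with the finite sets
  \<open>R\<close> and \<open>C\<close> of row and column labels.  The literal arrays with rows \<open>[F]\<close> and columns \<open>[K]\<close>
  are the case \<open>R = {1..F}\<close>, \<open>C = {1..K}\<close>; all PDA conditions are invariant under relabelling.
  Parameter order follows the usual \<open>(K,F,Z,S)\<close> convention: \<open>K\<close> columns, \<open>F\<close> rows.
\<close>

definition array_shape ::
  "'r set \<Rightarrow> 'c set \<Rightarrow> ('r \<Rightarrow> 'c \<Rightarrow> entry) \<Rightarrow> nat \<Rightarrow> nat \<Rightarrow> nat \<Rightarrow> bool" where
  "array_shape R C p K F S \<longleftrightarrow>
     finite R \<and> card R = F \<and> finite C \<and> card C = K \<and>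
     (\<forall>f\<in>R. \<forall>k\<in>C. p f k = Star \<or> (\<exists>s\<in>{1..S}. p f k = Num s))"

definition PDA_A1 :: "'r set \<Rightarrow> 'c set \<Rightarrow> ('r \<Rightarrow> 'c \<Rightarrow> entry) \<Rightarrow> nat \<Rightarrow> bool" where
  "PDA_A1 R C p Z \<longleftrightarrow> (\<forall>k\<in>C. card {f\<in>R. p f k = Star} = Z)"

definition PDA_A2 :: "'r set \<Rightarrow> 'c set \<Rightarrow> ('r \<Rightarrow> 'c \<Rightarrow> entry) \<Rightarrow> nat \<Rightarrow> bool" where
  "PDA_A2 R C p S \<longleftrightarrow> (\<forall>s\<in>{1..S}. \<exists>f\<in>R. \<exists>k\<in>C. p f k = Num s)"

definition PDA_A2_regular ::
  "'r set \<Rightarrow> 'c set \<Rightarrow> ('r \<Rightarrow> 'c \<Rightarrow> entry) \<Rightarrow> nat \<Rightarrow> nat \<Rightarrow> bool" where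
  "PDA_A2_regular R C p g S \<longleftrightarrow>
     (\<forall>s\<in>{1..S}. card {(f, k). f \<in> R \<and> k \<in> C \<and> p f k = Num s} = g)"

definition PDA_A3 :: "'r set \<Rightarrow> 'c set \<Rightarrow> ('r \<Rightarrow> 'c \<Rightarrow> entry) \<Rightarrow> bool" where
  "PDA_A3 R C p \<longleftrightarrow>
     (\<forall>f1\<in>R. \<forall>k1\<in>C. \<forall>f2\<in>R. \<forall>k2\<in>C. \<forall>s.
        (f1, k1) \<noteq> (f2, k2) \<and> p f1 k1 = Num s \<and> p f2 k2 = Num s \<longrightarrow>
        f1 \<noteq> f2 \<and> k1 \<noteq> k2 \<and> p f1 k2 = Star \<and> p f2 k1 = Star)"

definition is_PDA ::
  "'r set \<Rightarrow> 'c set \<Rightarrow> ('r \<Rightarrow> 'c \<Rightarrow> entry) \<Rightarrow> nat \<Rightarrow> nat \<Rightarrow> nat \<Rightarrow> nat \<Rightarrow> bool" where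
  "is_PDA R C p K F Z S \<longleftrightarrow>
     0 < K \<and> 0 < F \<and> 0 < Z \<and> 0 < S \<and> array_shape R C p K F S \<and>
     PDA_A1 R C p Z \<and> PDA_A2 R C p S \<and> PDA_A3 R C p"

definition is_regular_PDA ::
  "nat \<Rightarrow> 'r set \<Rightarrow> 'c set \<Rightarrow> ('r \<Rightarrow> 'c \<Rightarrow> entry) \<Rightarrow> nat \<Rightarrow> nat \<Rightarrow> nat \<Rightarrow> nat \<Rightarrow> bool" where
  "is_regular_PDA g R C p K F Z S \<longleftrightarrow>
     0 < K \<and> 0 < F \<and> 0 < Z \<and> 0 < S \<and> array_shape R C p K F S \<and>
     PDA_A1 R C p Z \<and> PDA_A2_regular R C p g S \<and> PDA_A3 R C p"

text \<open>
  \<open>lex_pos F t Y\<close> is the position, counted from 1, of \<open>Y\<close> among the \<open>t\<close>-subsets of \<open>[F]\<close>, where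
  subsets are compared lexicographically as increasing sequences.
\<close>

definition lex_pos :: "nat \<Rightarrow> nat \<Rightarrow> nat set \<Rightarrow> nat" where
  "lex_pos F t Y = Suc (card {X \<in> nsets {1..F} t.
     (sorted_list_of_set X, sorted_list_of_set Y) \<in> lexord less_than})"

definition subset_array :: "nat \<Rightarrow> nat \<Rightarrow> nat set \<Rightarrow> nat \<Rightarrow> entry" where
  "subset_array F \<alpha> T d = (if d \<in> T then Star else Num (lex_pos F (\<alpha> + 1) (T \<union> {d})))"

definition transpose_array :: "('r \<Rightarrow> 'c \<Rightarrow> entry) \<Rightarrow> 'c \<Rightarrow> 'r \<Rightarrow> entry" where
  "transpose_array p = (\<lambda>c r. p r c)"

text \<open>
  In the block array, row \<open>(i, r)\<close> is row \<open>r\<close> of block row \<open>i\<close>, and column \<open>(j, c)\<close> is column \<open>c\<close>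
  of block column \<open>j\<close>.
\<close>

definition block_diag_array :: "('r \<Rightarrow> 'c \<Rightarrow> entry) \<Rightarrow> nat \<times> 'r \<Rightarrow> nat \<times> 'c \<Rightarrow> entry" where
  "block_diag_array p = (\<lambda>(i, r) (j, c). if i = j then p r c else Star)"

end

(* A cell (T, d) with d not in T carries the number of the set Y = insert d T, and numbering is
   injective, so the cells with that number are exactly (Y - {d}, d) for d in Y: there are
   alpha + 1 of them.  Two distinct such cells have d1 \<noteq> d2, hence d2 \<in> T1 and d1 \<in> T2, which puts
   stars at the crossing cells.  These conditions are symmetric in rows and columns, and in the
   block array cells of different blocks cross at stars. *)
theory Submission imports Defs begin

section \<open>Ranks in finite strict linear orders, and the lexicographic numbering of
  subsets\<close>

lemma bij_betw_rank:
  assumes "finite A" and "trans r" and "irrefl r" and "total_on A r"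
  shows "bij_betw (\<lambda>y. Suc (card {x \<in> A. (x, y) \<in> r})) A {1..card A}"
proof -
  define rk where "rk y = Suc (card {x \<in> A. (x, y) \<in> r})" for y
  have mono: "rk x < rk y" if "x \<in> A" "(x, y) \<in> r" for x y
  proof -
    \<comment> \<open>Inclusion is transitivity; it is strict because \<open>x\<close> lies below
      \<open>y\<close> but not below itself.\<close>
    have "{z \<in> A. (z, x) \<in> r} \<subset> {z \<in> A. (z, y) \<in> r}"
      using that \<open>trans r\<close> \<open>irrefl r\<close> by (auto simp: irrefl_def dest: transD)
    then show ?thesis
      unfolding rk_def using \<open>finite A\<close> by (simp add: psubset_card_mono)
  qed
  have inj: "inj_on rk A"
  proof (rule inj_onI, rule ccontr)
    fix x y assume "x \<in> A" "y \<in> A" "rk x = rk y" "x \<noteq> y"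
    then show False
      using mono[of x y] mono[of y x] \<open>total_on A r\<close> by (auto simp: total_on_def)
  qed
  have "rk y \<le> card A" if "y \<in> A" for y
  proof -
    \<comment> \<open>\<open>y\<close> is not below itself, so it has fewer than
      \<open>card A\<close> predecessors, and the \<open>Suc\<close> keeps the rank within
      \<open>card A\<close>.\<close>
    have "{x \<in> A. (x, y) \<in> r} \<subset> A"
      using that \<open>irrefl r\<close> by (auto simp: irrefl_def)
    then show ?thesis
      unfolding rk_def using \<open>finite A\<close> by (simp add: psubset_card_mono Suc_leI)
  qed
  then have "rk ` A \<subseteq> {1..card A}"
    by (auto simp: rk_def)
  \<comment> \<open>Surjectivity by counting: the injective image has \<open>card A\<close> elements
    inside a set of that size.\<close>
  then have "rk ` A = {1..card A}"
    by (rule card_subset_eq[OF finite_atLeastAtMost]) (simp add: card_image inj)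
  with inj show ?thesis
    unfolding bij_betw_def rk_def by blast
qed

text \<open>The lexicographic order on lists, pulled back along \<open>sorted_list_of_set\<close>,
  is a strict linear order on the t-subsets, so \<open>lex_pos\<close> is a rank function.\<close>

lemma bij_betw_lex_pos:
  "bij_betw (lex_pos F t) (nsets {1..F} t) {1..F choose t}"
proof -
  let ?r = "inv_image (lexord (less_than :: nat rel)) sorted_list_of_set"
  have "finite (nsets {1..F} t)"
    by (simp add: finite_imp_finite_nsets)
  moreover have "trans ?r"
    by (intro trans_inv_image lexord_transI trans_less_than)
  moreover have "irrefl ?r"
    by (simp add: irrefl_def lexord_irreflexive)
  moreover have "total_on (nsets {1..F} t) ?r"
  proof (rule total_onI)
    fix X Y :: "nat set"
    assume "X \<in> nsets {1..F} t" "Y \<in> nsets {1..F} t" "X \<noteq> Y"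
    \<comment> \<open>Members of \<open>nsets\<close> are finite, so each is recovered as the set of
      its sorted list; infinite sets would all be sent to the empty list.\<close>
    then have "sorted_list_of_set X \<noteq> sorted_list_of_set Y"
      by (metis (mono_tags, lifting) mem_Collect_eq nsets_def set_sorted_list_of_set)
    then show "(X, Y) \<in> ?r \<or> (Y, X) \<in> ?r"
      using lexord_linear[of less_than "sorted_list_of_set X" "sorted_list_of_set Y"]
      by (simp add: less_linear)
  qed
  ultimately have "bij_betw (\<lambda>Y. Suc (card {X \<in> nsets {1..F} t. (X, Y) \<in> ?r}))
      (nsets {1..F} t) {1..card (nsets {1..F} t)}"
    by (rule bij_betw_rank)
  then show ?thesis
    unfolding lex_pos_def by simp
qed

section \<open>The array indexed by subsets and points: entries, stars and multiplicities\<close>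

lemma insert_in_nsets:
  "T \<in> nsets A n \<Longrightarrow> d \<in> A \<Longrightarrow> d \<notin> T \<Longrightarrow> insert d T \<in> nsets A (Suc n)"
  by (auto simp: nsets_def)

text \<open>Deleting \<open>d\<close> inverts inserting it, which leaves the (n-1)-subsets of
  \<open>A - {d}\<close> to count. At n = 0 the truncated \<open>n - 1\<close> would give 1 instead
  of 0.\<close>

lemma card_nsets_containing:
  assumes "finite A" and "d \<in> A" and "0 < n"
  shows "card {T \<in> nsets A n. d \<in> T} = (card A - 1) choose (n - 1)"
proof -
  have "bij_betw (insert d) (nsets (A - {d}) (n - 1)) {T \<in> nsets A n. d \<in> T}"
    by (rule bij_betw_byWitness[where f' = "\<lambda>T. T - {d}"])
      (use assms in \<open>auto simp: nsets_def card_insert_if\<close>)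
  then have "card {T \<in> nsets A n. d \<in> T} = card (nsets (A - {d}) (n - 1))"
    by (metis bij_betw_same_card)
  then show ?thesis
    using assms by simp
qed

text \<open>Injectivity of the numbering turns equal numbers into equal sets, so the counting of
  occurrences and the check of A3 can argue with sets alone.\<close>

lemma subset_array_eq_Num_iff:
  assumes "T \<in> nsets {1..F} \<alpha>" "d \<in> {1..F}" "Y \<in> nsets {1..F} (\<alpha> + 1)"
  shows "subset_array F \<alpha> T d = Num (lex_pos F (\<alpha> + 1) Y) \<longleftrightarrow> d \<notin> T \<and> insert d T = Y"
proof -
  have "insert d T = Y" if "d \<notin> T" "lex_pos F (Suc \<alpha>) (insert d T) = lex_pos F (Suc \<alpha>) Y"
    using bij_betw_imp_inj_on[OF bij_betw_lex_pos] insert_in_nsets[of T _ \<alpha> d] assms that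
    by (metis Suc_eq_plus1 inj_onD)
  then show ?thesis
    by (auto simp: subset_array_def)
qed

lemma subset_array_shape:
  "array_shape (nsets {1..F} \<alpha>) {1..F} (subset_array F \<alpha>) F (F choose \<alpha>) (F choose (\<alpha> + 1))"
proof -
  have "lex_pos F (Suc \<alpha>) (insert d T) \<in> {1..F choose Suc \<alpha>}"
    if "T \<in> nsets {1..F} \<alpha>" "d \<in> {1..F}" "d \<notin> T" for T d
    using bij_betw_apply[OF bij_betw_lex_pos insert_in_nsets[OF that]] .
  then show ?thesis
    unfolding array_shape_def
    by (auto simp: finite_imp_finite_nsets subset_array_def)
qed

lemma subset_array_A2_regular:
  "PDA_A2_regular (nsets {1..F} \<alpha>) {1..F} (subset_array F \<alpha>) (\<alpha> + 1) (F choose (\<alpha> + 1))"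
  unfolding PDA_A2_regular_def
proof
  fix s assume "s \<in> {1..F choose (\<alpha> + 1)}"
  \<comment> \<open>Surjectivity of the numbering: every admissible integer is the number of some
    set.\<close>
  then obtain Y where Y: "Y \<in> nsets {1..F} (\<alpha> + 1)" and s: "s = lex_pos F (\<alpha> + 1) Y"
    using bij_betw_imp_surj_on[OF bij_betw_lex_pos] by (metis imageE)
  have "{(T, d). T \<in> nsets {1..F} \<alpha> \<and> d \<in> {1..F} \<and> subset_array F \<alpha> T d = Num s} =
      {(T, d). T \<in> nsets {1..F} \<alpha> \<and> d \<in> {1..F} \<and> d \<notin> T \<and> insert d T = Y}"
    unfolding s using subset_array_eq_Num_iff[OF _ _ Y] by blast
  \<comment> \<open>Once \<open>d\<close> in \<open>Y\<close> is chosen, \<open>T\<close> is forced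
    to be \<open>Y - {d}\<close>; the second coordinate makes this parametrization
    injective.\<close>
  also have "\<dots> = (\<lambda>d. (Y - {d}, d)) ` Y"
    using Y by (fastforce simp: nsets_def image_iff)
  finally have "card {(T, d). T \<in> nsets {1..F} \<alpha> \<and> d \<in> {1..F} \<and> subset_array F \<alpha> T d = Num s}
      = card Y"
    by (simp add: card_image inj_on_def)
  then show "card {(T, d). T \<in> nsets {1..F} \<alpha> \<and> d \<in> {1..F} \<and> subset_array F \<alpha> T d = Num s}
      = \<alpha> + 1"
    using Y by (simp add: nsets_def)
qed

lemma subset_array_A3:
  "PDA_A3 (nsets {1..F} \<alpha>) {1..F} (subset_array F \<alpha>)"
  unfolding PDA_A3_def
proof (intro ballI allI impI, elim conjE)
  fix T1 d1 T2 d2 s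
  assume T: "T1 \<in> nsets {1..F} \<alpha>" "T2 \<in> nsets {1..F} \<alpha>"
    and d: "d1 \<in> {1..F}" "d2 \<in> {1..F}" and ne: "(T1, d1) \<noteq> (T2, d2)"
    and s: "subset_array F \<alpha> T1 d1 = Num s" "subset_array F \<alpha> T2 d2 = Num s"
  from s have notin: "d1 \<notin> T1" "d2 \<notin> T2"
    by (auto simp: subset_array_def split: if_splits)
  have Y: "insert d2 T2 \<in> nsets {1..F} (\<alpha> + 1)"
    using insert_in_nsets[OF T(2) d(2) notin(2)] by simp
  have "subset_array F \<alpha> T1 d1 = Num (lex_pos F (\<alpha> + 1) (insert d2 T2))"
    using s notin by (simp add: subset_array_def)
  then have eq: "insert d1 T1 = insert d2 T2"
    using subset_array_eq_Num_iff[OF T(1) d(1) Y] by simp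
  \<comment> \<open>If the points agreed, removing the common point, which is in neither
    \<open>T1\<close> nor \<open>T2\<close>, would give \<open>T1 = T2\<close> and hence the same
    cell.\<close>
  with ne notin have "d1 \<noteq> d2"
    by (metis insert_ident)
  with eq have "d2 \<in> T1" "d1 \<in> T2"
    by auto
  \<comment> \<open>\<open>T1\<close> and \<open>T2\<close> differ because \<open>d2\<close> lies in
    the first but not in the second.\<close>
  with notin \<open>d1 \<noteq> d2\<close>
  show "T1 \<noteq> T2 \<and> d1 \<noteq> d2 \<and> subset_array F \<alpha> T1 d2 = Star \<and> subset_array F \<alpha> T2 d1 = Star"
    by (auto simp: subset_array_def)
qed

lemma subset_array_eq_Star_iff [simp]: "subset_array F \<alpha> T d = Star \<longleftrightarrow> d \<in> T"
  by (simp add: subset_array_def)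

lemma subset_array_A1:
  assumes "0 < \<alpha>"
  shows "PDA_A1 (nsets {1..F} \<alpha>) {1..F} (subset_array F \<alpha>) ((F - 1) choose (\<alpha> - 1))"
  using assms by (simp add: PDA_A1_def card_nsets_containing)

text \<open>A column of the transpose belongs to a set \<open>T\<close>, and its stars sit exactly
  at the elements of \<open>T\<close>.\<close>

lemma transpose_subset_array_A1:
  "PDA_A1 {1..F} (nsets {1..F} \<alpha>) (transpose_array (subset_array F \<alpha>)) \<alpha>"
  unfolding PDA_A1_def
proof
  fix T assume "T \<in> nsets {1..F} \<alpha>"
  then have "{d \<in> {1..F}. transpose_array (subset_array F \<alpha>) d T = Star} = T" "card T = \<alpha>"
    by (auto simp: nsets_def transpose_array_def)
  then show "card {d \<in> {1..F}. transpose_array (subset_array F \<alpha>) d T = Star} = \<alpha>"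
    by simp
qed

section \<open>Transposition of arrays\<close>

lemma array_shape_transpose:
  "array_shape R C p K F S \<Longrightarrow> array_shape C R (transpose_array p) F K S"
  by (auto simp: array_shape_def transpose_array_def)

lemma PDA_A2_regular_transpose:
  assumes "PDA_A2_regular R C p g S"
  shows "PDA_A2_regular C R (transpose_array p) g S"
proof -
  \<comment> \<open>Occurrences in the transpose are the original ones with coordinates swapped, and
    swapping is injective.\<close>
  have "{(k, f). k \<in> C \<and> f \<in> R \<and> p f k = Num s} =
      prod.swap ` {(f, k). f \<in> R \<and> k \<in> C \<and> p f k = Num s}" for s
    by auto
  then show ?thesis
    using assms by (simp add: PDA_A2_regular_def transpose_array_def card_image)
qed

lemma PDA_A3_transpose:
  "PDA_A3 R C p \<Longrightarrow> PDA_A3 C R (transpose_array p)"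
  unfolding PDA_A3_def transpose_array_def by blast

section \<open>From regular PDAs to block-diagonal arrays\<close>

lemma is_regular_PDA_imp_is_PDA:
  assumes "is_regular_PDA g R C p K F Z S" and "0 < g"
  shows "is_PDA R C p K F Z S"
proof -
  have "\<exists>f\<in>R. \<exists>k\<in>C. p f k = Num s" if "s \<in> {1..S}" for s
  proof -
    have "card {(f, k). f \<in> R \<and> k \<in> C \<and> p f k = Num s} \<noteq> 0"
      using assms that by (simp add: is_regular_PDA_def PDA_A2_regular_def)
    then have "{(f, k). f \<in> R \<and> k \<in> C \<and> p f k = Num s} \<noteq> {}"
      by (metis card.empty)
    then show ?thesis by auto
  qed
  then show ?thesis
    using assms(1) by (simp add: is_PDA_def is_regular_PDA_def PDA_A2_def)
qed

text \<open>All diagonal blocks reuse the same integers, so \<open>S\<close> stays fixed while each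
  integer occurs \<open>n\<close> times as often; hence the plain notion of PDA instead of the
  g-regular one.\<close>

lemma is_PDA_block_diag:
  assumes "is_PDA R C p K F Z S" and "0 < n"
  shows "is_PDA ({1..n} \<times> R) ({1..n} \<times> C) (block_diag_array p)
    (n * K) (n * F) ((n - 1) * F + Z) S"
proof -
  from assms have pos: "0 < K" "0 < F" "0 < Z" "0 < S"
    and shape: "array_shape R C p K F S"
    and A1: "PDA_A1 R C p Z" and A2: "PDA_A2 R C p S" and A3: "PDA_A3 R C p"
    by (auto simp: is_PDA_def)
  from shape have fin: "finite R" "finite C" and card: "card R = F" "card C = K"
    by (auto simp: array_shape_def)
  have "array_shape ({1..n} \<times> R) ({1..n} \<times> C) (block_diag_array p) (n * K) (n * F) S"
    using shape by (auto simp: array_shape_def block_diag_array_def)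
  moreover have "PDA_A1 ({1..n} \<times> R) ({1..n} \<times> C) (block_diag_array p) ((n - 1) * F + Z)"
    unfolding PDA_A1_def
  proof
    fix jc assume "jc \<in> {1..n} \<times> C"
    then obtain j c where jc: "jc = (j, c)" "j \<in> {1..n}" "c \<in> C"
      by auto
    \<comment> \<open>A column meets \<open>n - 1\<close> all-star blocks of \<open>F\<close> rows
      each, and one copy of \<open>p\<close> contributing \<open>Z\<close> stars.\<close>
    have "{ir \<in> {1..n} \<times> R. block_diag_array p ir jc = Star} =
        ({1..n} - {j}) \<times> R \<union> {j} \<times> {r \<in> R. p r c = Star}"
      using jc by (auto simp: block_diag_array_def split: if_splits)
    also have "card \<dots> = card (({1..n} - {j}) \<times> R) + card ({j} \<times> {r \<in> R. p r c = Star})"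
      using fin by (intro card_Un_disjoint) auto
    also have "\<dots> = (n - 1) * F + Z"
      using A1 jc card by (simp add: card_cartesian_product PDA_A1_def)
    finally show "card {ir \<in> {1..n} \<times> R. block_diag_array p ir jc = Star} = (n - 1) * F + Z" .
  qed
  moreover have "PDA_A2 ({1..n} \<times> R) ({1..n} \<times> C) (block_diag_array p) S"
    unfolding PDA_A2_def
  proof
    fix s assume "s \<in> {1..S}"
    then obtain r c where "r \<in> R" "c \<in> C" "p r c = Num s"
      using A2 unfolding PDA_A2_def by blast
    \<comment> \<open>Every integer already occurs in the first diagonal block, which exists since
      \<open>0 < n\<close>.\<close>
    then have "(1, r) \<in> {1..n} \<times> R" "(1, c) \<in> {1..n} \<times> C"
        "block_diag_array p (1, r) (1, c) = Num s"
      using \<open>0 < n\<close> by (auto simp: block_diag_array_def)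
    then show "\<exists>f\<in>{1..n} \<times> R. \<exists>k\<in>{1..n} \<times> C. block_diag_array p f k = Num s"
      by blast
  qed
  moreover have "PDA_A3 ({1..n} \<times> R) ({1..n} \<times> C) (block_diag_array p)"
    unfolding PDA_A3_def
  proof (intro ballI allI impI, elim conjE)
    fix f1 k1 f2 k2 s
    assume mem: "f1 \<in> {1..n} \<times> R" "k1 \<in> {1..n} \<times> C" "f2 \<in> {1..n} \<times> R" "k2 \<in> {1..n} \<times> C"
      and ne: "(f1, k1) \<noteq> (f2, k2)"
      and s: "block_diag_array p f1 k1 = Num s" "block_diag_array p f2 k2 = Num s"
    \<comment> \<open>An integer entry can only lie in a diagonal block, so its row and column share
      the block index.\<close>
    obtain i r1 c1 where 1: "f1 = (i, r1)" "k1 = (i, c1)" "p r1 c1 = Num s"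
      using s(1) by (cases f1; cases k1) (auto simp: block_diag_array_def split: if_splits)
    obtain j r2 c2 where 2: "f2 = (j, r2)" "k2 = (j, c2)" "p r2 c2 = Num s"
      using s(2) by (cases f2; cases k2) (auto simp: block_diag_array_def split: if_splits)
    show "f1 \<noteq> f2 \<and> k1 \<noteq> k2 \<and> block_diag_array p f1 k2 = Star \<and> block_diag_array p f2 k1 = Star"
    \<comment> \<open>Within one block A3 of \<open>p\<close> applies; for different blocks the
      indices separate rows and columns, and both crossing cells lie off the diagonal.\<close>
    proof (cases "i = j")
      case True
      then have "r1 \<noteq> r2 \<and> c1 \<noteq> c2 \<and> p r1 c2 = Star \<and> p r2 c1 = Star"
        using A3[unfolded PDA_A3_def, rule_format, of r1 c1 r2 c2 s] mem ne 1 2 by auto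
      then show ?thesis
        using True 1 2 by (simp add: block_diag_array_def)
    next
      case False
      then show ?thesis
        using 1 2 by (simp add: block_diag_array_def)
    qed
  qed
  ultimately show ?thesis
    using pos \<open>0 < n\<close> by (simp add: is_PDA_def)
qed

theorem mainTheorem3:
  fixes F \<alpha> K :: nat
  assumes "0 < F" and "2 \<le> K" and "\<alpha> \<in> {1..F - 1}"
  shows "is_regular_PDA (\<alpha> + 1) (nsets {1..F} \<alpha>) {1..F} (subset_array F \<alpha>)
           F (F choose \<alpha>) ((F - 1) choose (\<alpha> - 1)) (F choose (\<alpha> + 1)) \<and>
         is_regular_PDA (\<alpha> + 1) {1..F} (nsets {1..F} \<alpha>) (transpose_array (subset_array F \<alpha>))
           (F choose \<alpha>) F \<alpha> (F choose (\<alpha> + 1)) \<and>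
         is_PDA ({1..K} \<times> {1..F}) ({1..K} \<times> nsets {1..F} \<alpha>)
           (block_diag_array (transpose_array (subset_array F \<alpha>)))
           (K * (F choose \<alpha>)) (K * F) ((K - 1) * F + \<alpha>) (F choose (\<alpha> + 1))"
proof -
  have \<alpha>: "0 < \<alpha>" "\<alpha> < F"
    using assms by auto
  \<comment> \<open>PDA parameters must be positive. Since \<alpha> < F, each lower index is at most
    its upper index, including \<open>\<alpha> + 1\<close> against \<open>F\<close>.\<close>
  then have pos: "0 < F choose \<alpha>" "0 < F choose (\<alpha> + 1)" "0 < (F - 1) choose (\<alpha> - 1)"
    by (auto intro!: zero_less_binomial simp del: binomial_Suc_Suc)
  have "is_regular_PDA (\<alpha> + 1) (nsets {1..F} \<alpha>) {1..F} (subset_array F \<alpha>)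
      F (F choose \<alpha>) ((F - 1) choose (\<alpha> - 1)) (F choose (\<alpha> + 1))"
    unfolding is_regular_PDA_def
    using \<open>0 < F\<close> pos subset_array_shape subset_array_A1[OF \<alpha>(1)] subset_array_A2_regular
      subset_array_A3 by blast
  moreover have transposed: "is_regular_PDA (\<alpha> + 1) {1..F} (nsets {1..F} \<alpha>)
      (transpose_array (subset_array F \<alpha>)) (F choose \<alpha>) F \<alpha> (F choose (\<alpha> + 1))"
    unfolding is_regular_PDA_def
    using \<open>0 < F\<close> \<alpha> pos array_shape_transpose[OF subset_array_shape] transpose_subset_array_A1
      PDA_A2_regular_transpose[OF subset_array_A2_regular] PDA_A3_transpose[OF subset_array_A3]
    by blast
  moreover have "is_PDA ({1..K} \<times> {1..F}) ({1..K} \<times> nsets {1..F} \<alpha>)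
      (block_diag_array (transpose_array (subset_array F \<alpha>)))
      (K * (F choose \<alpha>)) (K * F) ((K - 1) * F + \<alpha>) (F choose (\<alpha> + 1))"
    \<comment> \<open>The diagonal block has \<open>F\<close> rows and \<alpha> stars per column,
      which gives the star count \<open>(K - 1) * F + \<alpha>\<close>.\<close>
    using is_PDA_block_diag[OF is_regular_PDA_imp_is_PDA[OF transposed]] \<open>2 \<le> K\<close> by simp
  ultimately show ?thesis
    by blast
qed

end
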